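(* Let $Q$ be a skew symmetric core of order $q$ with $q>1$, and let $m$ be a positive integer. Then the quaternary unit Hadamard matrix $$\frac{1}{\sqrt{q+1}}\,\mathcal{J}^{(q)}_m+i\sqrt{\frac{q}{q+1}}\,\mathcal{A}^{(q)}_m$$ is in the Bose-Mesner algebra of the association scheme $\mathfrak{X}^{(q)}_m$.
   Context: A Hadamard matrix of order $n$ is an $n\times n$ $(\pm1)$-matrix $H$ with $HH^T=nI_n$; it is of skew type if $H=I+W$ with $W$ a skew symmetric $(0,\pm1)$-matrix. A skew symmetric core of order $q$ is a $q\times q$ matrix $Q$ such that $\begin{pmatrix}1 & j\\ -j^T & I+Q\end{pmatrix}$ is a skew type Hadamard matrix of order $q+1$, where $j$ is the $1\times q$ all-ones matrix. Such $Q$ is a skew symmetric $(0,\pm1)$-matrix with $J_qQ=QJ_q=0$ and $QQ^T=qI_q-J_q$, where $J_n$ denotes the $n\times n$ all-ones matrix. Given $Q$, define recursively $\mathcal{J}^{(q)}_0=\mathcal{A}^{(q)}_0=J_1$ and, for $m\ge1$, $\mathcal{J}^{(q)}_m=J_q\otimes\mathcal{A}^{(q)}_{m-1}$, $\mathcal{A}^{(q)}_m=I_q\otimes\mathcal{J}^{(q)}_{m-1}+Q\otimes\mathcal{A}^{(q)}_{m-1}$. Write $Q=A_1-A_2$ with $A_1,A_2$ disjoint $(0,1)$-matrices (no common nonzero position), and let $A_0=I_q$. The matrices $A_0,A_1,A_2$ are the adjacency matrices of a commutative association scheme $\mathfrak{X}^{(q)}$. The association scheme $\mathfrak{X}^{(q)}_m$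 is the $m$-fold tensor product of $\mathfrak{X}^{(q)}$: its adjacency matrices are $A_{i_1}\otimes\cdots\otimes A_{i_m}$ with $(i_1,\dots,i_m)\in\{0,1,2\}^m$. The Bose-Mesner algebra of an association scheme is the complex vector space spanned by its adjacency matrices. A quaternary unit Hadamard matrix (with parameter $q$) of order $n$ is an $n\times n$ complex matrix $H$ with $HH^*=nI_n$ and all entries in $\left\{\epsilon\frac{1}{\sqrt{q+1}}+\delta\, i\sqrt{\frac{q}{q+1}} : \epsilon,\delta\in\{1,-1\}\right\}$. *)

theory Defs
  imports Complex_Main "Jordan_Normal_Form.VS_Connect" "Jordan_Normal_Form.Schur_Decomposition"
begin

text \<open>All matrices are complex matrices, also those with entries in \<open>{0, 1, -1}\<close>.\<close>

definition all_ones_mat :: "nat \<Rightarrow> nat \<Rightarrow> complex mat" where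
  "all_ones_mat nr nc = mat nr nc (\<lambda>_. 1)"

text \<open>Kronecker product, with the usual block convention: the block of \<open>kron A B\<close> in
  position \<open>(i, j)\<close> is \<open>(A $$ (i, j)) \<cdot>\<^sub>m B\<close>.\<close>

definition kron :: "complex mat \<Rightarrow> complex mat \<Rightarrow> complex mat" (infixr "\<otimes>\<^sub>K" 70) where
  "A \<otimes>\<^sub>K B = mat (dim_row A * dim_row B) (dim_col A * dim_col B)
     (\<lambda>(i, j). A $$ (i div dim_row B, j div dim_col B) * B $$ (i mod dim_row B, j mod dim_col B))"

definition hadamard_mat :: "nat \<Rightarrow> complex mat \<Rightarrow> bool" where
  "hadamard_mat n H \<longleftrightarrow> H \<in> carrier_mat n n \<and> elements_mat H \<subseteq> {1, -1} \<and>
     H * transpose_mat H = of_nat n \<cdot>\<^sub>m 1\<^sub>m n"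

definition skew_type_hadamard_mat :: "nat \<Rightarrow> complex mat \<Rightarrow> bool" where
  "skew_type_hadamard_mat n H \<longleftrightarrow> hadamard_mat n H \<and>
     (\<exists>W \<in> carrier_mat n n. elements_mat W \<subseteq> {0, 1, -1} \<and> transpose_mat W = - W \<and> H = 1\<^sub>m n + W)"

definition skew_symmetric_core :: "nat \<Rightarrow> complex mat \<Rightarrow> bool" where
  "skew_symmetric_core q Q \<longleftrightarrow> Q \<in> carrier_mat q q \<and>
     skew_type_hadamard_mat (q + 1)
       (four_block_mat (1\<^sub>m 1) (all_ones_mat 1 q) (- transpose_mat (all_ones_mat 1 q)) (1\<^sub>m q + Q))"

fun rec_J :: "nat \<Rightarrow> complex mat \<Rightarrow> nat \<Rightarrow> complex mat"
  and rec_A :: "nat \<Rightarrow> complex mat \<Rightarrow> nat \<Rightarrow> complex mat" where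
  "rec_J q Q 0 = all_ones_mat 1 1"
| "rec_A q Q 0 = all_ones_mat 1 1"
| "rec_J q Q (Suc m) = all_ones_mat q q \<otimes>\<^sub>K rec_A q Q m"
| "rec_A q Q (Suc m) = (1\<^sub>m q \<otimes>\<^sub>K rec_J q Q m) + (Q \<otimes>\<^sub>K rec_A q Q m)"

definition quaternary_unit_hadamard_mat :: "nat \<Rightarrow> nat \<Rightarrow> complex mat \<Rightarrow> bool" where
  "quaternary_unit_hadamard_mat q n H \<longleftrightarrow> H \<in> carrier_mat n n \<and>
     H * mat_adjoint H = of_nat n \<cdot>\<^sub>m 1\<^sub>m n \<and>
     elements_mat H \<subseteq>
       {\<epsilon> * complex_of_real (1 / sqrt (real q + 1))
          + \<delta> * \<i> * complex_of_real (sqrt (real q / (real q + 1))) |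
        \<epsilon> \<delta>. \<epsilon> \<in> {1, -1} \<and> \<delta> \<in> {1, -1}}"

definition zero_one_mat :: "complex mat \<Rightarrow> bool" where
  "zero_one_mat A \<longleftrightarrow> elements_mat A \<subseteq> {0, 1}"

definition disjoint_decomposition :: "nat \<Rightarrow> complex mat \<Rightarrow> complex mat \<Rightarrow> complex mat \<Rightarrow> bool" where
  "disjoint_decomposition q Q A1 A2 \<longleftrightarrow>
     A1 \<in> carrier_mat q q \<and> A2 \<in> carrier_mat q q \<and> zero_one_mat A1 \<and> zero_one_mat A2 \<and>
     (\<forall>i<q. \<forall>j<q. A1 $$ (i, j) = 0 \<or> A2 $$ (i, j) = 0) \<and>
     Q = A1 - A2"

text \<open>A commutative association scheme on \<open>n\<close> points, given by its family \<open>A\<close> of adjacency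
  matrices indexed by \<open>K\<close>. The numbers \<open>p k\<close> are the intersection numbers; sums of matrices are
  written entrywise.\<close>

definition commutative_association_scheme :: "nat \<Rightarrow> 'k set \<Rightarrow> ('k \<Rightarrow> complex mat) \<Rightarrow> bool" where
  "commutative_association_scheme n K A \<longleftrightarrow>
     finite K \<and>
     (\<forall>k\<in>K. A k \<in> carrier_mat n n \<and> zero_one_mat (A k) \<and> A k \<noteq> 0\<^sub>m n n) \<and>
     (\<exists>k\<in>K. A k = 1\<^sub>m n) \<and>
     (\<forall>x<n. \<forall>y<n. (\<Sum>k\<in>K. A k $$ (x, y)) = 1) \<and>
     (\<forall>k\<in>K. \<exists>k'\<in>K. transpose_mat (A k) = A k') \<and>
     (\<forall>i\<in>K. \<forall>j\<in>K. \<exists>p :: 'k \<Rightarrow> nat. \<forall>x<n. \<forall>y<n.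
        (A i * A j) $$ (x, y) = (\<Sum>k\<in>K. of_nat (p k) * A k $$ (x, y))) \<and>
     (\<forall>i\<in>K. \<forall>j\<in>K. A i * A j = A j * A i)"

definition bose_mesner_algebra :: "nat \<Rightarrow> 'k set \<Rightarrow> ('k \<Rightarrow> complex mat) \<Rightarrow> complex mat set" where
  "bose_mesner_algebra n K A =
     LinearCombinations.module.span class_ring (module_mat TYPE(complex) n n) (A ` K)"

definition tensor_index :: "nat \<Rightarrow> nat list set" where
  "tensor_index m = {is. length is = m \<and> set is \<subseteq> {0, 1, 2}}"

definition tensor_adj :: "nat \<Rightarrow> complex mat \<Rightarrow> complex mat \<Rightarrow> nat list \<Rightarrow> complex mat" where
  "tensor_adj q A1 A2 is = foldr (\<lambda>i B. ([1\<^sub>m q, A1, A2] ! i) \<otimes>\<^sub>K B) is (1\<^sub>m 1)"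

end

theory Submission
  imports Defs
begin

text \<open>Write \<open>J\<close>, \<open>A\<close> for the two recursively defined matrices of order \<open>q ^ m\<close>. Since \<open>J\<^sub>q Q = 0\<close> and
  \<open>Q Q\<^sup>T = q I - J\<^sub>q\<close>, the identities \<open>J J\<^sup>T + q A A\<^sup>T = q\<^sup>m (q + 1) I\<close> and \<open>A J\<^sup>T = J A\<^sup>T\<close> follow
  simultaneously by induction on \<open>m\<close>; they give the Hadamard property. The span of \<open>I\<close>, \<open>J\<^sub>q\<close>, \<open>Q\<close>
  is closed under multiplication and equals that of \<open>I\<close>, \<open>A\<^sub>1\<close>, \<open>A\<^sub>2\<close>, so these form a scheme;
  Kronecker products of schemes are schemes, and \<open>J\<close>, \<open>A\<close> are built from \<open>I\<close>, \<open>J\<^sub>q\<close>, \<open>Q\<close> by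
  Kronecker products and sums.\<close>

section \<open>Kronecker products\<close>

lemma div_mod_less_mult:
  fixes x :: nat
  assumes "x < a * b"
  shows "x div b < a" "x mod b < b"
proof -
  have "b > 0" using assms by (cases b) auto
  then show "x div b < a" "x mod b < b"
    using assms by (auto simp: less_mult_imp_div_less)
qed

lemma pair_less_mult:
  fixes x :: nat
  assumes "x < a" "y < b"
  shows "x * b + y < a * b"
proof -
  have "x * b + y < Suc x * b" using assms by simp
  also have "\<dots> \<le> a * b" using assms by (intro mult_le_mono1) simp
  finally show ?thesis .
qed

text \<open>Division with remainder by \<open>b\<close> identifies the indices below
  \<open>a * b\<close> with pairs. This splits the inner sum in a product of two Kronecker
  products.\<close>

lemma sum_div_mod:
  fixes f :: "nat \<Rightarrow> nat \<Rightarrow> 'a :: comm_monoid_add"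
  shows "(\<Sum>k<a * b. f (k div b) (k mod b)) = (\<Sum>i<a. \<Sum>j<b. f i j)"
proof -
  have "(\<Sum>i<a. \<Sum>j<b. f i j) = (\<Sum>(i, j)\<in>{..<a} \<times> {..<b}. f i j)"
    by (simp add: sum.cartesian_product)
  also have "\<dots> = (\<Sum>k<a * b. f (k div b) (k mod b))"
    by (rule sum.reindex_bij_witness[where i = "\<lambda>k. (k div b, k mod b)" and j = "\<lambda>(i, j). i * b + j"])
       (auto simp: div_mod_less_mult intro: pair_less_mult)
  finally show ?thesis by simp
qed

lemma kron_carrier:
  assumes "A \<in> carrier_mat a b" "B \<in> carrier_mat c d"
  shows "A \<otimes>\<^sub>K B \<in> carrier_mat (a * c) (b * d)"
  using assms by (auto simp: kron_def)

lemma kron_index: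
  assumes "A \<in> carrier_mat a b" "B \<in> carrier_mat c d" "x < a * c" "y < b * d"
  shows "(A \<otimes>\<^sub>K B) $$ (x, y) = A $$ (x div c, y div d) * B $$ (x mod c, y mod d)"
  using assms by (auto simp: kron_def)

lemma mult_index_sum:
  assumes "A \<in> carrier_mat n k" "B \<in> carrier_mat k m" "x < n" "y < m"
  shows "(A * B) $$ (x, y) = (\<Sum>z<k. A $$ (x, z) * B $$ (z, y))"
  using assms by (auto simp: scalar_prod_def atLeast0LessThan intro!: sum.cong)

text \<open>Mixed-product rule at one position: once the inner index is split, the summand is a
  factor in \<open>i\<close> times a factor in \<open>j\<close>, so the double sum factors. The Gram
  identities are computed with this entrywise form.\<close>

lemma kron_mult_index:
  assumes A: "A \<in> carrier_mat a b" and B: "B \<in> carrier_mat c d"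
    and C: "C \<in> carrier_mat b e" and D: "D \<in> carrier_mat d f"
    and xy: "x < a * c" "y < e * f"
  shows "((A \<otimes>\<^sub>K B) * (C \<otimes>\<^sub>K D)) $$ (x, y) =
    (A * C) $$ (x div c, y div f) * (B * D) $$ (x mod c, y mod f)"
proof -
  note bounds = div_mod_less_mult[OF xy(1)] div_mod_less_mult[OF xy(2)]
  have "((A \<otimes>\<^sub>K B) * (C \<otimes>\<^sub>K D)) $$ (x, y) =
      (\<Sum>z<b * d. (A \<otimes>\<^sub>K B) $$ (x, z) * (C \<otimes>\<^sub>K D) $$ (z, y))"
    by (rule mult_index_sum[OF kron_carrier[OF A B] kron_carrier[OF C D] xy])
  also have "\<dots> = (\<Sum>z<b * d. (A $$ (x div c, z div d) * C $$ (z div d, y div f)) *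
      (B $$ (x mod c, z mod d) * D $$ (z mod d, y mod f)))"
    using xy by (intro sum.cong) (auto simp: kron_index[OF A B] kron_index[OF C D])
  also have "\<dots> = (\<Sum>i<b. \<Sum>j<d. (A $$ (x div c, i) * C $$ (i, y div f)) *
      (B $$ (x mod c, j) * D $$ (j, y mod f)))"
    by (rule sum_div_mod)
  also have "\<dots> = (A * C) $$ (x div c, y div f) * (B * D) $$ (x mod c, y mod f)"
    by (simp add: mult_index_sum[OF A C bounds(1,3)] mult_index_sum[OF B D bounds(2,4)] sum_product)
  finally show ?thesis .
qed

lemma kron_mult:
  assumes A: "A \<in> carrier_mat a b" and B: "B \<in> carrier_mat c d"
    and C: "C \<in> carrier_mat b e" and D: "D \<in> carrier_mat d f"
  shows "(A \<otimes>\<^sub>K B) * (C \<otimes>\<^sub>K D) = (A * C) \<otimes>\<^sub>K (B * D)" (is "?l = ?r")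
proof -
  have AC: "A * C \<in> carrier_mat a e" and BD: "B * D \<in> carrier_mat c f"
    using assms by auto
  have l: "?l \<in> carrier_mat (a * c) (e * f)"
    using kron_carrier[OF A B] kron_carrier[OF C D] by auto
  note r = kron_carrier[OF AC BD]
  show ?thesis
    by (rule eq_matI)
       (use l r in \<open>auto simp: kron_mult_index[OF assms] kron_index[OF AC BD]\<close>)
qed

lemma kron_transpose:
  assumes A: "A \<in> carrier_mat a b" and B: "B \<in> carrier_mat c d"
  shows "transpose_mat (A \<otimes>\<^sub>K B) = transpose_mat A \<otimes>\<^sub>K transpose_mat B"
proof -
  have AT: "transpose_mat A \<in> carrier_mat b a" and BT: "transpose_mat B \<in> carrier_mat d c"
    using assms by auto
  note l = kron_carrier[OF A B] and r = kron_carrier[OF AT BT]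
  show ?thesis
    by (rule eq_matI)
       (use l r A B in \<open>auto simp: kron_index[OF A B] kron_index[OF AT BT] div_mod_less_mult\<close>)
qed

lemma kron_one: "1\<^sub>m a \<otimes>\<^sub>K 1\<^sub>m b = 1\<^sub>m (a * b)"
proof (rule eq_matI)
  fix x y assume "x < dim_row (1\<^sub>m (a * b) :: complex mat)" "y < dim_col (1\<^sub>m (a * b) :: complex mat)"
  then have xy: "x < a * b" "y < a * b" by auto
  have "x = y \<longleftrightarrow> x div b = y div b \<and> x mod b = y mod b"
    by (metis div_mult_mod_eq)
  then show "(1\<^sub>m a \<otimes>\<^sub>K 1\<^sub>m b) $$ (x, y) = 1\<^sub>m (a * b) $$ (x, y)"
    using xy div_mod_less_mult[OF xy(1)] div_mod_less_mult[OF xy(2)]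
    by (simp add: kron_index[of _ a a _ b b])
qed (auto simp: kron_def)

section \<open>Association schemes\<close>

lemma zero_one_matD:
  assumes "zero_one_mat A" "A \<in> carrier_mat n m" "x < n" "y < m"
  shows "A $$ (x, y) = 0 \<or> A $$ (x, y) = 1"
  using assms elements_matI[of A n m x y "A $$ (x, y)"] unfolding zero_one_mat_def by blast

lemma zero_one_matI:
  assumes "A \<in> carrier_mat n m" "\<And>x y. x < n \<Longrightarrow> y < m \<Longrightarrow> A $$ (x, y) \<in> {0, 1}"
  shows "zero_one_mat A"
  using assms elements_matD unfolding zero_one_mat_def by blast

lemma nonzero_entry:
  assumes "M \<in> carrier_mat n m" "M \<noteq> 0\<^sub>m n m"
  shows "\<exists>x<n. \<exists>y<m. M $$ (x, y) \<noteq> 0"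
proof (rule ccontr)
  assume "\<not> ?thesis"
  then have "M = 0\<^sub>m n m"
    using assms(1) by (intro eq_matI) auto
  then show False using assms(2) by blast
qed

lemma commutative_association_schemeD:
  assumes "commutative_association_scheme n K A"
  shows "finite K"
    and "\<And>k. k \<in> K \<Longrightarrow> A k \<in> carrier_mat n n"
    and "\<And>k. k \<in> K \<Longrightarrow> zero_one_mat (A k)"
    and "\<And>k. k \<in> K \<Longrightarrow> A k \<noteq> 0\<^sub>m n n"
    and "\<exists>k\<in>K. A k = 1\<^sub>m n"
    and "\<And>x y. x < n \<Longrightarrow> y < n \<Longrightarrow> (\<Sum>k\<in>K. A k $$ (x, y)) = 1"
    and "\<And>k. k \<in> K \<Longrightarrow> \<exists>k'\<in>K. transpose_mat (A k) = A k'"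
    and "\<And>i j. i \<in> K \<Longrightarrow> j \<in> K \<Longrightarrow> \<exists>p. \<forall>x<n. \<forall>y<n.
        (A i * A j) $$ (x, y) = (\<Sum>k\<in>K. of_nat (p k) * A k $$ (x, y))"
    and "\<And>i j. i \<in> K \<Longrightarrow> j \<in> K \<Longrightarrow> A i * A j = A j * A i"
  using assms unfolding commutative_association_scheme_def by auto

lemma Nats_sum_closed:
  fixes f :: "'b \<Rightarrow> 'a :: semiring_1"
  assumes "\<And>x. x \<in> X \<Longrightarrow> f x \<in> \<nat>"
  shows "sum f X \<in> \<nat>"
  using assms by (induction X rule: infinite_finite_induct) auto

text \<open>Complex coefficients suffice: evaluating the expansion of \<open>A i * A j\<close> at a position where
  \<open>A k\<close> is nonzero, all other matrices vanish, so the coefficient of \<open>A k\<close> is an entry of a product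
  of two \<open>(0, 1)\<close>-matrices.\<close>

lemma commutative_association_schemeI:
  fixes A :: "'k \<Rightarrow> complex mat"
  assumes fin: "finite K"
    and carr: "\<And>k. k \<in> K \<Longrightarrow> A k \<in> carrier_mat n n"
    and zo: "\<And>k. k \<in> K \<Longrightarrow> zero_one_mat (A k)"
    and nz: "\<And>k. k \<in> K \<Longrightarrow> A k \<noteq> 0\<^sub>m n n"
    and id: "\<exists>k\<in>K. A k = 1\<^sub>m n"
    and total: "\<And>x y. x < n \<Longrightarrow> y < n \<Longrightarrow> (\<Sum>k\<in>K. A k $$ (x, y)) = 1"
    and trans: "\<And>k. k \<in> K \<Longrightarrow> \<exists>k'\<in>K. transpose_mat (A k) = A k'"
    and prod: "\<And>i j. i \<in> K \<Longrightarrow> j \<in> K \<Longrightarrow> \<exists>c :: 'k \<Rightarrow> complex. \<forall>x<n. \<forall>y<n.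
        (A i * A j) $$ (x, y) = (\<Sum>k\<in>K. c k * A k $$ (x, y))"
    and comm: "\<And>i j. i \<in> K \<Longrightarrow> j \<in> K \<Longrightarrow> A i * A j = A j * A i"
  shows "commutative_association_scheme n K A"
proof -
  have int: "\<exists>p :: 'k \<Rightarrow> nat. \<forall>x<n. \<forall>y<n.
      (A i * A j) $$ (x, y) = (\<Sum>k\<in>K. of_nat (p k) * A k $$ (x, y))"
    if ij: "i \<in> K" "j \<in> K" for i j
  proof -
    obtain c :: "'k \<Rightarrow> complex" where c: "\<And>x y. x < n \<Longrightarrow> y < n \<Longrightarrow>
        (A i * A j) $$ (x, y) = (\<Sum>k\<in>K. c k * A k $$ (x, y))"
      using prod[OF ij] by blast
    have "c k \<in> \<nat>" if k: "k \<in> K" for k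
    proof -
      obtain x y where xy: "x < n" "y < n" and one: "A k $$ (x, y) = 1"
        using nonzero_entry[OF carr[OF k] nz[OF k]] zero_one_matD[OF zo[OF k] carr[OF k]] by blast
      have zo': "A l $$ (x, y) \<in> {0, 1}" if "l \<in> K" for l
        using zero_one_matD[OF zo[OF that] carr[OF that] xy] by blast
      have "(\<Sum>l\<in>K - {k}. A l $$ (x, y)) = 0"
        using total[OF xy] one k fin by (simp add: sum.remove)
      \<comment> \<open>Real parts of entries in \<open>{0, 1}\<close> are nonnegative, so a
        vanishing sum forces each of them, and hence each entry, to vanish.\<close>
      then have "(\<Sum>l\<in>K - {k}. Re (A l $$ (x, y))) = 0"
        by (metis Re_sum zero_complex.simps(1))
      then have "\<forall>l\<in>K - {k}. Re (A l $$ (x, y)) = 0"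
        using fin zo' by (subst (asm) sum_nonneg_eq_0_iff) fastforce+
      then have zero: "A l $$ (x, y) = 0" if "l \<in> K - {k}" for l
        using zo'[of l] that by force
      have "(A i * A j) $$ (x, y) = c k * A k $$ (x, y) + (\<Sum>l\<in>K - {k}. c l * A l $$ (x, y))"
        using c[OF xy] fin k by (simp add: sum.remove)
      then have "(A i * A j) $$ (x, y) = c k"
        by (simp add: one zero)
      moreover have "(A i * A j) $$ (x, y) \<in> \<nat>"
        unfolding mult_index_sum[OF carr[OF ij(1)] carr[OF ij(2)] xy]
        using zero_one_matD[OF zo carr] ij xy
        by (intro Nats_sum_closed Nats_mult) (metis Nats_0 Nats_1 lessThan_iff)+
      ultimately show ?thesis by simp
    qed
    then have "\<forall>k\<in>K. \<exists>m. c k = of_nat m" by (auto simp: Nats_def)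
    then obtain p where p: "\<forall>k\<in>K. c k = of_nat (p k)" by metis
    show ?thesis
      using c p by (intro exI[of _ p]) simp
  qed
  show ?thesis
    unfolding commutative_association_scheme_def
    by (intro conjI ballI allI impI fin carr zo nz id total trans int comm)
qed

text \<open>The Kronecker construction indexes its family by pairs, the tensor scheme by lists; an
  injection on the indices carries all axioms across.\<close>

lemma commutative_association_scheme_reindex:
  assumes inj: "inj_on f K" and S: "commutative_association_scheme n K (\<lambda>k. A (f k))"
  shows "commutative_association_scheme n (f ` K) A"
proof (rule commutative_association_schemeI)
  note D = commutative_association_schemeD[OF S]
  have reindex: "(\<Sum>k\<in>f ` K. g k) = (\<Sum>k\<in>K. g (f k))" for g :: "_ \<Rightarrow> complex"
    using inj by (simp add: sum.reindex)
  fix i j assume "i \<in> f ` K" "j \<in> f ` K"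
  then obtain i' j' where ij: "i = f i'" "j = f j'" "i' \<in> K" "j' \<in> K" by blast
  obtain p :: "_ \<Rightarrow> nat" where p: "\<forall>x<n. \<forall>y<n.
      (A i * A j) $$ (x, y) = (\<Sum>k\<in>K. of_nat (p k) * A (f k) $$ (x, y))"
    using D(8)[OF ij(3,4)] ij by blast
  show "\<exists>c :: _ \<Rightarrow> complex. \<forall>x<n. \<forall>y<n. (A i * A j) $$ (x, y) = (\<Sum>k\<in>f ` K. c k * A k $$ (x, y))"
    \<comment> \<open>The coefficient at a new index is the intersection number at its unique
      preimage under \<open>f\<close>.\<close>
    using p inj by (intro exI[of _ "\<lambda>k. of_nat (p (the_inv_into K f k))"])
      (auto simp: reindex the_inv_into_f_f)
qed (use commutative_association_schemeD[OF S] inj in \<open>auto simp: sum.reindex\<close>)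

section \<open>Kronecker products of schemes\<close>

lemma kron_nonzero:
  assumes A: "A \<in> carrier_mat a a" "A \<noteq> 0\<^sub>m a a" and B: "B \<in> carrier_mat b b" "B \<noteq> 0\<^sub>m b b"
  shows "A \<otimes>\<^sub>K B \<noteq> 0\<^sub>m (a * b) (a * b)"
proof
  assume zero: "A \<otimes>\<^sub>K B = 0\<^sub>m (a * b) (a * b)"
  obtain x y where xy: "x < a" "y < a" "A $$ (x, y) \<noteq> 0" using nonzero_entry[OF A] by blast
  obtain u v where uv: "u < b" "v < b" "B $$ (u, v) \<noteq> 0" using nonzero_entry[OF B] by blast
  have "(A \<otimes>\<^sub>K B) $$ (x * b + u, y * b + v) = A $$ (x, y) * B $$ (u, v)"
    using xy uv by (subst kron_index[OF A(1) B(1)]) (auto intro: pair_less_mult)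
  moreover have "x * b + u < a * b" "y * b + v < a * b"
    using xy uv by (auto intro: pair_less_mult)
  ultimately show False using zero xy(3) uv(3) by simp
qed

text \<open>Entries of a Kronecker product are products of entries, so each sum over
  \<open>K \<times> L\<close> factors into a sum over \<open>K\<close> and one over
  \<open>L\<close>. Identity, transposes and products are found in each factor separately.\<close>

lemma commutative_association_scheme_kron:
  assumes S: "commutative_association_scheme n K A" and T: "commutative_association_scheme m L B"
  shows "commutative_association_scheme (n * m) (K \<times> L) (\<lambda>(k, l). A k \<otimes>\<^sub>K B l)"
proof -
  note D = commutative_association_schemeD[OF S] and E = commutative_association_schemeD[OF T]
  have factor: "(\<Sum>(k, l)\<in>K \<times> L. f k * g l) = (\<Sum>k\<in>K. f k) * (\<Sum>l\<in>L. g l)"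
    for f :: "_ \<Rightarrow> complex" and g
    by (simp add: sum_product sum.cartesian_product)
  show ?thesis
  proof (rule commutative_association_schemeI, goal_cases)
    case 1
    show ?case using D(1) E(1) by simp
  next
    case (2 k)
    then show ?case using D(2) E(2) by (auto intro: kron_carrier)
  next
    case (3 k)
    obtain i j where k: "k = (i, j)" "i \<in> K" "j \<in> L" using 3 by auto
    show ?case
      unfolding k(1) prod.case
    proof (rule zero_one_matI[OF kron_carrier[OF D(2)[OF k(2)] E(2)[OF k(3)]]])
      fix x y assume xy: "x < n * m" "y < n * m"
      show "(A i \<otimes>\<^sub>K B j) $$ (x, y) \<in> {0, 1}"
        unfolding kron_index[OF D(2)[OF k(2)] E(2)[OF k(3)] xy]
        using zero_one_matD[OF D(3)[OF k(2)] D(2)[OF k(2)], of "x div m" "y div m"]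
          zero_one_matD[OF E(3)[OF k(3)] E(2)[OF k(3)], of "x mod m" "y mod m"]
          div_mod_less_mult[OF xy(1)] div_mod_less_mult[OF xy(2)] by auto
    qed
  next
    case (4 k)
    then show ?case using kron_nonzero[OF D(2,4) E(2,4)] by auto
  next
    case 5
    obtain k l where "k \<in> K" "A k = 1\<^sub>m n" "l \<in> L" "B l = 1\<^sub>m m"
      using D(5) E(5) by blast
    then show ?case by (intro bexI[of _ "(k, l)"]) (auto simp: kron_one)
  next
    case (6 x y)
    have "(\<Sum>k\<in>K \<times> L. (case k of (k, l) \<Rightarrow> A k \<otimes>\<^sub>K B l) $$ (x, y)) =
        (\<Sum>(k, l)\<in>K \<times> L. A k $$ (x div m, y div m) * B l $$ (x mod m, y mod m))"
      using 6 by (intro sum.cong) (auto simp: kron_index[OF D(2) E(2)])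
    then show ?case
      using 6 by (simp add: factor D(6) E(6) div_mod_less_mult)
  next
    case (7 k)
    then obtain i j where k: "k = (i, j)" "i \<in> K" "j \<in> L" by auto
    obtain i' j' where "i' \<in> K" "transpose_mat (A i) = A i'" "j' \<in> L" "transpose_mat (B j) = B j'"
      using D(7)[OF k(2)] E(7)[OF k(3)] by blast
    then show ?case
      using k by (intro bexI[of _ "(i', j')"]) (auto simp: kron_transpose[OF D(2) E(2)])
  next
    case (8 a b)
    then obtain i j i' j' where ij: "a = (i, i')" "b = (j, j')" "i \<in> K" "j \<in> K" "i' \<in> L" "j' \<in> L"
      by auto
    obtain p where p: "\<forall>x<n. \<forall>y<n. (A i * A j) $$ (x, y) = (\<Sum>k\<in>K. of_nat (p k) * A k $$ (x, y))"
      using D(8) ij by blast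
    obtain r where r: "\<forall>x<m. \<forall>y<m. (B i' * B j') $$ (x, y) = (\<Sum>k\<in>L. of_nat (r k) * B k $$ (x, y))"
      using E(8) ij by blast
    show ?case
    \<comment> \<open>Intersection numbers of the product scheme are products of those of the
      factors.\<close>
    proof (intro exI[of _ "\<lambda>(k, l). of_nat (p k) * of_nat (r l)"] allI impI, goal_cases)
      case (1 x y)
      have "(\<Sum>k\<in>K \<times> L. (case k of (k, l) \<Rightarrow> of_nat (p k) * of_nat (r l)) *
            (case k of (k, l) \<Rightarrow> A k \<otimes>\<^sub>K B l) $$ (x, y)) =
          (\<Sum>(k, l)\<in>K \<times> L. (of_nat (p k) * A k $$ (x div m, y div m)) *
            (of_nat (r l) * B l $$ (x mod m, y mod m)))"
        using 1 by (intro sum.cong) (auto simp: kron_index[OF D(2) E(2)])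
      also have "\<dots> = (A i * A j) $$ (x div m, y div m) * (B i' * B j') $$ (x mod m, y mod m)"
        using 1 p r by (simp add: factor div_mod_less_mult)
      also have "\<dots> = ((A i \<otimes>\<^sub>K B i') * (A j \<otimes>\<^sub>K B j')) $$ (x, y)"
        using 1 ij by (simp add: kron_mult_index[OF D(2) E(2) D(2) E(2)])
      finally show ?case using ij by simp
    qed
  next
    case (9 a b)
    then obtain i j i' j' where ij: "a = (i, i')" "b = (j, j')" "i \<in> K" "j \<in> K" "i' \<in> L" "j' \<in> L"
      by auto
    then show ?case
      using D(9)[OF ij(3,4)] E(9)[OF ij(5,6)] by (simp add: kron_mult[OF D(2) E(2) D(2) E(2)])
  qed
qed

section \<open>Tensor powers of a scheme\<close>

lemma commutative_association_scheme_trivial: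
  "commutative_association_scheme 1 {k} (\<lambda>_. 1\<^sub>m 1)"
proof (rule commutative_association_schemeI)
  have "(1\<^sub>m 1 :: complex mat) $$ (0, 0) \<noteq> 0\<^sub>m 1 1 $$ (0, 0)" by simp
  then show "(1\<^sub>m 1 :: complex mat) \<noteq> 0\<^sub>m 1 1" by metis
  show "\<exists>c. \<forall>x<1. \<forall>y<1. (1\<^sub>m 1 * 1\<^sub>m 1) $$ (x, y) = (\<Sum>k\<in>{k}. c k * 1\<^sub>m 1 $$ (x, y))"
    by (rule exI[of _ "\<lambda>_. 1"]) (simp add: scalar_prod_def)
qed (auto intro!: zero_one_matI[of _ 1 1])

lemma tensor_index_0: "tensor_index 0 = {[]}"
  by (auto simp: tensor_index_def)

lemma tensor_index_Suc:
  "tensor_index (Suc m) = (\<lambda>(i, is). i # is) ` ({0, 1, 2} \<times> tensor_index m)"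
  by (auto simp: tensor_index_def length_Suc_conv image_iff)

lemma inj_case_prod_Cons: "inj_on (\<lambda>(i, is). i # is) X"
  by (auto simp: inj_on_def)

lemma tensor_adj_Cons:
  "tensor_adj q A1 A2 (i # is) = ([1\<^sub>m q, A1, A2] ! i) \<otimes>\<^sub>K tensor_adj q A1 A2 is"
  by (simp add: tensor_adj_def)

text \<open>Prepending an index amounts to one Kronecker product with the base scheme, and it is
  injective on pairs; so the step is the product construction followed by reindexing, starting from
  the one-point scheme.\<close>

lemma commutative_association_scheme_tensor:
  assumes "commutative_association_scheme q {0, 1, 2} (\<lambda>i. [1\<^sub>m q, A1, A2] ! i)"
  shows "commutative_association_scheme (q ^ m) (tensor_index m) (tensor_adj q A1 A2)"
proof (induction m)
  case 0
  have "commutative_association_scheme 1 ((\<lambda>_. []) ` {()}) (tensor_adj q A1 A2)"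
    using commutative_association_scheme_trivial[of "()"]
    by (intro commutative_association_scheme_reindex) (auto simp: tensor_adj_def)
  then show ?case by (simp add: tensor_index_0)
next
  case (Suc m)
  have "commutative_association_scheme (q * q ^ m) ({0, 1, 2} \<times> tensor_index m)
      (\<lambda>z. tensor_adj q A1 A2 ((\<lambda>(i, is). i # is) z))"
    using commutative_association_scheme_kron[OF assms Suc]
    by (simp add: tensor_adj_Cons case_prod_unfold)
  then show ?case
    unfolding tensor_index_Suc power_Suc
    by (rule commutative_association_scheme_reindex[OF inj_case_prod_Cons])
qed


section \<open>Membership in the Bose-Mesner algebra\<close>

text \<open>A span is a submodule. Restating this with the matrix operations keeps the module
  structure out of the later proofs.\<close>

lemma bose_mesner_algebra_closed:
  fixes A :: "'k \<Rightarrow> complex mat"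
  assumes carr: "\<And>k. k \<in> K \<Longrightarrow> A k \<in> carrier_mat n n"
  shows "0\<^sub>m n n \<in> bose_mesner_algebra n K A"
    and "k \<in> K \<Longrightarrow> A k \<in> bose_mesner_algebra n K A"
    and "X \<in> bose_mesner_algebra n K A \<Longrightarrow> Y \<in> bose_mesner_algebra n K A \<Longrightarrow>
      X + Y \<in> bose_mesner_algebra n K A"
    and "X \<in> bose_mesner_algebra n K A \<Longrightarrow> c \<cdot>\<^sub>m X \<in> bose_mesner_algebra n K A"
proof -
  interpret vectorspace "class_ring :: complex ring" "module_mat TYPE(complex) n n"
    by (rule matrix_vs)
  have sub: "A ` K \<subseteq> carrier (module_mat TYPE(complex) n n)"
    using carr by (auto simp: module_mat_simps)
  interpret S: submodule class_ring "span (A ` K)" "module_mat TYPE(complex) n n"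
    by (rule span_is_submodule[OF sub])
  show "0\<^sub>m n n \<in> bose_mesner_algebra n K A"
    using S.zero_closed by (simp add: bose_mesner_algebra_def module_mat_simps)
  show "A k \<in> bose_mesner_algebra n K A" if "k \<in> K"
    using span_mem[OF sub] that by (simp add: bose_mesner_algebra_def)
  show "X + Y \<in> bose_mesner_algebra n K A"
    if "X \<in> bose_mesner_algebra n K A" "Y \<in> bose_mesner_algebra n K A"
    using S.m_closed that by (simp add: bose_mesner_algebra_def module_mat_simps)
  show "c \<cdot>\<^sub>m X \<in> bose_mesner_algebra n K A" if "X \<in> bose_mesner_algebra n K A"
    using S.smult_closed[of c X] that
    by (simp add: bose_mesner_algebra_def module_mat_simps class_ring_simps)
qed

lemma bose_mesner_algebraI:
  fixes A :: "'k \<Rightarrow> complex mat"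
  assumes fin: "finite K" and carr: "\<And>k. k \<in> K \<Longrightarrow> A k \<in> carrier_mat n n"
    and M: "M \<in> carrier_mat n n"
    and eq: "\<And>x y. x < n \<Longrightarrow> y < n \<Longrightarrow> M $$ (x, y) = (\<Sum>k\<in>K. c k * A k $$ (x, y))"
  shows "M \<in> bose_mesner_algebra n K A"
proof -
  let ?S = "\<lambda>L. mat n n (\<lambda>(x, y). \<Sum>k\<in>L. c k * A k $$ (x, y))"
  \<comment> \<open>Only the set of summands grows in the induction; the algebra stays that of the
    whole of \<open>K\<close>.\<close>
  have "?S L \<in> bose_mesner_algebra n K A" if "finite L" "L \<subseteq> K" for L
    using that
  proof (induction L)
    case empty
    have "?S {} = 0\<^sub>m n n" by (rule eq_matI) auto
    then show ?case using bose_mesner_algebra_closed(1)[where K = K and A = A, OF carr] by metis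
  next
    case (insert l L)
    have "?S (insert l L) = c l \<cdot>\<^sub>m A l + ?S L"
      by (rule eq_matI) (use insert carr[of l] in auto)
    moreover have "c l \<cdot>\<^sub>m A l + ?S L \<in> bose_mesner_algebra n K A"
      by (intro bose_mesner_algebra_closed[where K = K and A = A, OF carr]) (use insert in blast)+
    ultimately show ?case by metis
  qed
  moreover have "M = ?S K" by (rule eq_matI) (use M eq in auto)
  ultimately show ?thesis using fin by simp
qed

section \<open>Skew symmetric cores\<close>

text \<open>Everything is read off the bordered matrix \<open>S\<close>: skewness from the lower
  right block of \<open>W\<close>, the signs from the entries of \<open>S\<close>, zero row sums
  from orthogonality to the border row, and \<open>Q Q^T = q I - J\<close> from the inner products
  of the other rows.\<close>

lemma skew_symmetric_coreD:
  assumes core: "skew_symmetric_core q Q"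
  shows "Q \<in> carrier_mat q q"
    and "\<And>i j. i < q \<Longrightarrow> j < q \<Longrightarrow> Q $$ (j, i) = - Q $$ (i, j)"
    and "\<And>i j. i < q \<Longrightarrow> j < q \<Longrightarrow> i \<noteq> j \<Longrightarrow> Q $$ (i, j) = 1 \<or> Q $$ (i, j) = -1"
    and "\<And>i. i < q \<Longrightarrow> (\<Sum>j<q. Q $$ (i, j)) = 0"
    and "\<And>i j. i < q \<Longrightarrow> j < q \<Longrightarrow>
      (\<Sum>k<q. Q $$ (i, k) * Q $$ (j, k)) = (if i = j then of_nat q else 0) - 1"
proof -
  define S where "S = four_block_mat (1\<^sub>m 1) (all_ones_mat 1 q)
    (- transpose_mat (all_ones_mat 1 q)) (1\<^sub>m q + Q)"
  show Q: "Q \<in> carrier_mat q q"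
    using core by (simp add: skew_symmetric_core_def)
  obtain W where S: "S \<in> carrier_mat (q + 1) (q + 1)" "elements_mat S \<subseteq> {1, -1}"
      "S * transpose_mat S = of_nat (q + 1) \<cdot>\<^sub>m 1\<^sub>m (q + 1)"
    and W: "W \<in> carrier_mat (q + 1) (q + 1)" "transpose_mat W = - W" "S = 1\<^sub>m (q + 1) + W"
    using core unfolding skew_symmetric_core_def skew_type_hadamard_mat_def hadamard_mat_def S_def
    by auto
  have S_Suc: "S $$ (Suc i, Suc j) = (if i = j then 1 else 0) + Q $$ (i, j)" if "i < q" "j < q" for i j
    using that Q by (simp add: S_def all_ones_mat_def)
  have S_0: "S $$ (0, Suc j) = 1" "S $$ (Suc j, 0) = -1" "S $$ (0, 0) = 1" if "j < q" for j
    using that Q by (simp_all add: S_def all_ones_mat_def)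
  have QW: "Q $$ (i, j) = W $$ (Suc i, Suc j)" if "i < q" "j < q" for i j
    using S_Suc[OF that] that W(1) by (simp add: W(3))
  have skewW: "W $$ (y, x) = - W $$ (x, y)" if "x < q + 1" "y < q + 1" for x y
    using arg_cong[OF W(2), of "\<lambda>M. M $$ (x, y)"] that W(1) by simp
  show skew: "Q $$ (j, i) = - Q $$ (i, j)" if "i < q" "j < q" for i j
    using skewW[of "Suc i" "Suc j"] that by (simp add: QW)
  show "Q $$ (i, j) = 1 \<or> Q $$ (i, j) = -1" if "i < q" "j < q" "i \<noteq> j" for i j
  proof -
    have "S $$ (Suc i, Suc j) \<in> {1, -1}"
      using S(1,2) elements_matI[OF S(1), of "Suc i" "Suc j"] that by auto
    then show ?thesis using S_Suc that by simp
  qed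
  have SS: "(\<Sum>z<q + 1. S $$ (x, z) * S $$ (y, z)) = (if x = y then of_nat (q + 1) else 0)"
    if "x < q + 1" "y < q + 1" for x y
  proof -
    have "(\<Sum>z<q + 1. S $$ (x, z) * S $$ (y, z)) = (S * transpose_mat S) $$ (x, y)"
      using that S(1) by (subst mult_index_sum[OF S(1)]) auto
    then show ?thesis using that by (simp add: S(3))
  qed
  have delta: "(\<Sum>k<q. (if i = k then 1 else 0) * f k) = f i"
    "(\<Sum>k<q. f k * (if i = k then 1 else 0)) = f i"
    if "i < q" for i and f :: "nat \<Rightarrow> complex"
    using that by (simp_all add: if_distrib if_distribR cong: if_cong)
  show row: "(\<Sum>j<q. Q $$ (i, j)) = 0" if i: "i < q" for i
  proof -
    \<comment> \<open>Row \<open>Suc i\<close> is orthogonal to row 0. The border column contributes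
      -1, so the rest sums to 1, which is exactly the share of the identity matrix.\<close>
    have "(\<Sum>k<q. (if i = k then 1 else 0) * 1 + Q $$ (i, k)) = 1"
      using SS[of "Suc i" 0] i by (simp add: sum.lessThan_Suc_shift S_0 S_Suc del: sum.lessThan_Suc)
    then show ?thesis using delta(1)[OF i, of "\<lambda>_. 1"] by (simp add: sum.distrib)
  qed
  show "(\<Sum>k<q. Q $$ (i, k) * Q $$ (j, k)) = (if i = j then of_nat q else 0) - 1"
    if ij: "i < q" "j < q" for i j
  proof -
    \<comment> \<open>The leading 1 is the product of the two border entries -1.\<close>
    have "1 + (\<Sum>k<q. ((if i = k then 1 else 0) + Q $$ (i, k)) * ((if j = k then 1 else 0) + Q $$ (j, k))) =
        (if i = j then of_nat (q + 1) else 0)"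
      using SS[of "Suc i" "Suc j"] ij
      by (simp add: sum.lessThan_Suc_shift S_0 S_Suc del: sum.lessThan_Suc)
    \<comment> \<open>The mixed terms of the expansion collapse to \<open>Q $$ (j, i)\<close> and
      \<open>Q $$ (i, j)\<close>, which cancel by skewness.\<close>
    then have "1 + ((if j = i then 1 else 0) + (Q $$ (j, i) + Q $$ (i, j)) +
        (\<Sum>k<q. Q $$ (i, k) * Q $$ (j, k))) = (if i = j then of_nat (q + 1) else 0)"
      unfolding distrib_left distrib_right sum.distrib delta[OF ij(1)] delta[OF ij(2)]
      by (simp add: add_ac)
    then show ?thesis
      unfolding skew[OF ij] by (simp add: algebra_simps split: if_splits)
  qed
qed


section \<open>The algebra spanned by I, J and Q\<close>

text \<open>This is \<open>a I + b J + c Q\<close>. In these coordinates products and transposes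
  become arithmetic on triples, which serves both the base scheme and the recursion.\<close>

definition core_mat :: "nat \<Rightarrow> complex mat \<Rightarrow> complex \<Rightarrow> complex \<Rightarrow> complex \<Rightarrow> complex mat" where
  "core_mat q Q a b c = mat q q (\<lambda>(i, j). (if i = j then a else 0) + b + c * Q $$ (i, j))"

lemma core_mat_carrier [simp]: "core_mat q Q a b c \<in> carrier_mat q q"
  by (simp add: core_mat_def)

lemma core_mat_index [simp]:
  "i < q \<Longrightarrow> j < q \<Longrightarrow> core_mat q Q a b c $$ (i, j) = (if i = j then a else 0) + b + c * Q $$ (i, j)"
  by (simp add: core_mat_def)

lemma core_mat_eqI:
  assumes "M \<in> carrier_mat q q"
    and "\<And>i j. i < q \<Longrightarrow> j < q \<Longrightarrow> M $$ (i, j) = (if i = j then a else 0) + b + c * Q $$ (i, j)"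
  shows "M = core_mat q Q a b c"
  by (rule eq_matI) (use assms in \<open>auto simp: core_mat_def\<close>)

lemma core_mat_basis:
  assumes "skew_symmetric_core q Q"
  shows "1\<^sub>m q = core_mat q Q 1 0 0" "all_ones_mat q q = core_mat q Q 0 1 0" "Q = core_mat q Q 0 0 1"
  by (rule core_mat_eqI; use skew_symmetric_coreD(1)[OF assms] in \<open>simp add: all_ones_mat_def\<close>)+

lemma core_mat_transpose:
  assumes "skew_symmetric_core q Q"
  shows "transpose_mat (core_mat q Q a b c) = core_mat q Q a b (- c)"
proof (rule core_mat_eqI)
  fix i j assume "i < q" "j < q"
  then show "transpose_mat (core_mat q Q a b c) $$ (i, j) = (if i = j then a else 0) + b + - c * Q $$ (i, j)"
    using skew_symmetric_coreD(2)[OF assms, of i j] carrier_matD[OF core_mat_carrier[of q Q a b c]] by auto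
qed simp

text \<open>Multiply out with \<open>J J = q J\<close>, \<open>J Q = Q J = 0\<close> and
  \<open>Q Q = J - q I\<close>, the last from \<open>Q Q^T = q I - J\<close> and skewness. The
  result is symmetric in the two triples, so the algebra is commutative.\<close>

lemma core_mat_mult:
  assumes core: "skew_symmetric_core q Q"
  shows "core_mat q Q a b c * core_mat q Q a' b' c' =
    core_mat q Q (a * a' - of_nat q * c * c')
      (a * b' + a' * b + of_nat q * b * b' + c * c') (a * c' + a' * c)"
proof (rule core_mat_eqI)
  fix i j assume ij: "i < q" "j < q"
  note D = skew_symmetric_coreD[OF core]
  have col: "(\<Sum>k<q. Q $$ (k, j)) = 0"
    using D(4)[OF ij(2)] D(2)[OF ij(2)] by (simp add: sum_negf)
  have QQ: "(\<Sum>k<q. Q $$ (i, k) * Q $$ (k, j)) = 1 - (if i = j then of_nat q else 0)"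
    using D(5)[OF ij] D(2)[OF ij(2)] by (simp add: sum_negf)
  have delta: "(\<Sum>k<q. (if i = k then d else 0) * f k) = d * f i"
    "(\<Sum>k<q. f k * (if k = j then d else 0)) = f j * d"
    for d and f :: "nat \<Rightarrow> complex"
    using ij by (simp_all add: if_distrib if_distribR cong: if_cong)
  \<comment> \<open>The summand is grouped so that each Kronecker delta stands as a separate factor,
    and what remains involves only row sums, column sums and \<open>Q Q\<close>.\<close>
  have "(core_mat q Q a b c * core_mat q Q a' b' c') $$ (i, j) =
      (\<Sum>k<q. (if i = k then a else 0) * ((if k = j then a' else 0) + b' + c' * Q $$ (k, j)) +
        (b + c * Q $$ (i, k)) * (if k = j then a' else 0) +
        (b * b' + b * c' * Q $$ (k, j) + c * b' * Q $$ (i, k) + c * c' * (Q $$ (i, k) * Q $$ (k, j))))"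
    using ij by (subst mult_index_sum[OF core_mat_carrier core_mat_carrier])
      (auto intro!: sum.cong simp: algebra_simps)
  also have "\<dots> = a * ((if i = j then a' else 0) + b' + c' * Q $$ (i, j)) + (b + c * Q $$ (i, j)) * a' +
      (of_nat q * (b * b') + b * c' * (\<Sum>k<q. Q $$ (k, j)) + c * b' * (\<Sum>k<q. Q $$ (i, k)) +
        c * c' * (\<Sum>k<q. Q $$ (i, k) * Q $$ (k, j)))"
    unfolding sum.distrib delta sum_distrib_left[symmetric] by simp
  finally show "(core_mat q Q a b c * core_mat q Q a' b' c') $$ (i, j) =
      (if i = j then a * a' - of_nat q * c * c' else 0) +
      (a * b' + a' * b + of_nat q * b * b' + c * c') + (a * c' + a' * c) * Q $$ (i, j)"
    unfolding col D(4)[OF ij(1)] QQ by (cases "i = j") (simp_all add: algebra_simps)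
qed (rule mult_carrier_mat[OF core_mat_carrier core_mat_carrier])

text \<open>The decomposition is forced: \<open>A1 = (J - I + Q) / 2\<close> and
  \<open>A2 = (J - I - Q) / 2\<close>, since \<open>Q\<close> vanishes on the diagonal and is 1 or
  -1 elsewhere.\<close>

lemma disjoint_decomposition_core_mat:
  assumes core: "skew_symmetric_core q Q" and dec: "disjoint_decomposition q Q A1 A2"
  shows "A1 = core_mat q Q (-1/2) (1/2) (1/2)" "A2 = core_mat q Q (-1/2) (1/2) (-1/2)"
proof -
  note D = skew_symmetric_coreD[OF core]
  have A: "A1 \<in> carrier_mat q q" "A2 \<in> carrier_mat q q" "zero_one_mat A1" "zero_one_mat A2"
    "\<And>i j. i < q \<Longrightarrow> j < q \<Longrightarrow> A1 $$ (i, j) = 0 \<or> A2 $$ (i, j) = 0" "Q = A1 - A2"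
    using dec by (auto simp: disjoint_decomposition_def)
  have eq: "A1 $$ (i, j) = (if i = j then -1/2 else 0) + 1/2 + 1/2 * Q $$ (i, j) \<and>
      A2 $$ (i, j) = (if i = j then -1/2 else 0) + 1/2 + -1/2 * Q $$ (i, j)" if ij: "i < q" "j < q" for i j
  proof -
    have Qij: "Q $$ (i, j) = A1 $$ (i, j) - A2 $$ (i, j)"
      using A(1,2,6) ij by simp
    show ?thesis
    proof (cases "i = j")
      case True
      \<comment> \<open>On the diagonal \<open>A1\<close> and \<open>A2\<close> then agree, and
        disjointness makes both zero.\<close>
      then have "Q $$ (i, j) = 0" using D(2)[OF ij] by simp
      then show ?thesis using Qij A(5)[OF ij] True by auto
    next
      case False
      then show ?thesis
        using Qij D(3)[OF ij] A(5)[OF ij] zero_one_matD[OF A(3,1) ij] zero_one_matD[OF A(4,2) ij] by auto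
    qed
  qed
  show "A1 = core_mat q Q (-1/2) (1/2) (1/2)" "A2 = core_mat q Q (-1/2) (1/2) (-1/2)"
    by (rule core_mat_eqI; use A eq in blast)+
qed

text \<open>Change of basis by \<open>J = I + A1 + A2\<close> and
  \<open>Q = A1 - A2\<close>.\<close>

lemma core_mat_combination:
  assumes core: "skew_symmetric_core q Q" and dec: "disjoint_decomposition q Q A1 A2"
    and ij: "i < q" "j < q"
  shows "core_mat q Q a b c $$ (i, j) =
    (\<Sum>k\<in>{0, 1, 2}. [a + b, b + c, b - c] ! k * ([1\<^sub>m q, A1, A2] ! k) $$ (i, j))"
  using ij unfolding disjoint_decomposition_core_mat[OF core dec]
  by (simp add: numeral_2_eq_2) (simp add: field_simps)

text \<open>All three adjacency matrices lie in the commutative algebra of triples, and the change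
  of basis expands their products. Transposition swaps \<open>A1\<close> and \<open>A2\<close>
  because it negates \<open>Q\<close>.\<close>

lemma commutative_association_scheme_core:
  assumes core: "skew_symmetric_core q Q" and q: "q > 1" and dec: "disjoint_decomposition q Q A1 A2"
  shows "commutative_association_scheme q {0, 1, 2} (\<lambda>i. [1\<^sub>m q, A1, A2] ! i)"
proof -
  note D = skew_symmetric_coreD[OF core] and A = disjoint_decomposition_core_mat[OF core dec]
  have adj: "\<exists>a b c. [1\<^sub>m q, A1, A2] ! i = core_mat q Q a b c" if "i \<in> {0, 1, 2}" for i
    using that A core_mat_basis(1)[OF core] by (auto simp: numeral_2_eq_2) blast+
  have zo: "zero_one_mat A1" "zero_one_mat A2"
    using dec by (auto simp: disjoint_decomposition_def)
  \<comment> \<open>As \<open>q > 1\<close>, two opposite positions with opposite signs exist: one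
    is a 1 of \<open>A1\<close>, the other a 1 of \<open>A2\<close>, so neither matrix is
    zero.\<close>
  have Q01: "Q $$ (0, Suc 0) = 1 \<and> Q $$ (Suc 0, 0) = -1 \<or> Q $$ (0, Suc 0) = -1 \<and> Q $$ (Suc 0, 0) = 1"
    using D(3)[of 0 "Suc 0"] D(2)[of 0 "Suc 0"] q by auto
  have nz: "M \<noteq> 0\<^sub>m q q" if "i < q" "j < q" "M $$ (i, j) \<noteq> 0" for M :: "complex mat" and i j
    using that by auto
  have q': "0 < q" "Suc 0 < q" using q by auto
  show ?thesis
  proof (rule commutative_association_schemeI, goal_cases)
    case 1
    show ?case by simp
  next
    case (2 k)
    then show ?case using adj by fastforce
  next
    case (3 k)
    then show ?case
      using zo zero_one_matI[of "1\<^sub>m q" q q] by (auto simp: numeral_2_eq_2)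
  next
    case (4 k)
    have "A1 \<noteq> 0\<^sub>m q q" "A2 \<noteq> 0\<^sub>m q q"
      using Q01 q' nz[of 0 "Suc 0"] nz[of "Suc 0" 0] by (auto simp: A)
    moreover have "1\<^sub>m q \<noteq> (0\<^sub>m q q :: complex mat)"
      using nz[of 0 0] q' by auto
    ultimately show ?case using 4 by (auto simp: numeral_2_eq_2)
  next
    case 5
    then show ?case by (intro bexI[of _ 0]) auto
  next
    case (6 x y)
    then show ?case by (simp add: A numeral_2_eq_2)
  next
    case (7 k)
    have "transpose_mat A1 = A2" "transpose_mat A2 = A1"
      by (simp_all add: A core_mat_transpose[OF core])
    then show ?case using 7 by (auto simp: numeral_2_eq_2)
  next
    case (8 i j)
    then obtain a b c where "([1\<^sub>m q, A1, A2] ! i) * ([1\<^sub>m q, A1, A2] ! j) = core_mat q Q a b c"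
      using adj core_mat_mult[OF core] by metis
    then show ?case
      using core_mat_combination[OF core dec] by (intro exI[of _ "\<lambda>k. [a + b, b + c, b - c] ! k"]) auto
  next
    case (9 i j)
    then obtain a b c a' b' c' where eq: "[1\<^sub>m q, A1, A2] ! i = core_mat q Q a b c"
        "[1\<^sub>m q, A1, A2] ! j = core_mat q Q a' b' c'"
      using adj by meson
    show ?case unfolding eq core_mat_mult[OF core] by (simp add: algebra_simps)
  qed
qed

section \<open>The recursively defined matrices\<close>

lemma rec_carrier:
  assumes "Q \<in> carrier_mat q q"
  shows "rec_J q Q m \<in> carrier_mat (q ^ m) (q ^ m) \<and> rec_A q Q m \<in> carrier_mat (q ^ m) (q ^ m)"
proof (induction m)
  case (Suc m)
  show ?case using assms Suc kron_carrier[of _ q q _ "q ^ m" "q ^ m"] by (simp add: all_ones_mat_def)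
qed (simp add: all_ones_mat_def)

section \<open>Expansion in the tensor basis\<close>

text \<open>Coefficients multiply under Kronecker products: the head of the list selects the
  coefficient of the core matrix, the tail that of \<open>M\<close>.\<close>

lemma core_mat_kron_combination:
  assumes core: "skew_symmetric_core q Q" and dec: "disjoint_decomposition q Q A1 A2"
    and M: "M \<in> carrier_mat (q ^ m) (q ^ m)"
      "\<And>x y. x < q ^ m \<Longrightarrow> y < q ^ m \<Longrightarrow>
        M $$ (x, y) = (\<Sum>is\<in>tensor_index m. d is * tensor_adj q A1 A2 is $$ (x, y))"
    and T: "\<And>is. is \<in> tensor_index m \<Longrightarrow> tensor_adj q A1 A2 is \<in> carrier_mat (q ^ m) (q ^ m)"
    and xy: "x < q ^ Suc m" "y < q ^ Suc m"
  shows "(core_mat q Q a b c \<otimes>\<^sub>K M) $$ (x, y) =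
    (\<Sum>is\<in>tensor_index (Suc m). [a + b, b + c, b - c] ! hd is * d (tl is) * tensor_adj q A1 A2 is $$ (x, y))"
proof -
  have base: "[1\<^sub>m q, A1, A2] ! i \<in> carrier_mat q q" if "i \<in> {0, 1, 2}" for i
    using that dec by (auto simp: disjoint_decomposition_def numeral_2_eq_2)
  have xy': "x < q * q ^ m" "y < q * q ^ m" using xy by simp_all
  have kr: "(([1\<^sub>m q, A1, A2] ! i) \<otimes>\<^sub>K tensor_adj q A1 A2 is) $$ (x, y) =
      ([1\<^sub>m q, A1, A2] ! i) $$ (x div q ^ m, y div q ^ m) *
      tensor_adj q A1 A2 is $$ (x mod q ^ m, y mod q ^ m)"
    if "i \<in> {0, 1, 2}" "is \<in> tensor_index m" for i "is"
    by (rule kron_index[OF base[OF that(1)] T[OF that(2)] xy'])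
  note bounds = div_mod_less_mult[OF xy'(1)] div_mod_less_mult[OF xy'(2)]
  let ?N = "q ^ m"
  have "(core_mat q Q a b c \<otimes>\<^sub>K M) $$ (x, y) =
      core_mat q Q a b c $$ (x div ?N, y div ?N) * M $$ (x mod ?N, y mod ?N)"
    by (rule kron_index[OF core_mat_carrier M(1) xy'])
  also have "\<dots> = (\<Sum>i\<in>{0, 1, 2}. [a + b, b + c, b - c] ! i * ([1\<^sub>m q, A1, A2] ! i) $$ (x div ?N, y div ?N)) *
      (\<Sum>is\<in>tensor_index m. d is * tensor_adj q A1 A2 is $$ (x mod ?N, y mod ?N))"
    by (simp only: core_mat_combination[OF core dec bounds(1,3)] M(2)[OF bounds(2,4)])
  also have "\<dots> = (\<Sum>(i, is)\<in>{0, 1, 2} \<times> tensor_index m. [a + b, b + c, b - c] ! i * d is *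
      (([1\<^sub>m q, A1, A2] ! i) \<otimes>\<^sub>K tensor_adj q A1 A2 is) $$ (x, y))"
    unfolding sum_product sum.cartesian_product
    by (intro sum.cong refl) (simp add: case_prod_unfold mem_Times_iff kr del: insert_iff)
  also have "\<dots> = (\<Sum>is\<in>tensor_index (Suc m). [a + b, b + c, b - c] ! hd is * d (tl is) *
      tensor_adj q A1 A2 is $$ (x, y))"
    unfolding tensor_index_Suc sum.reindex[OF inj_case_prod_Cons]
    by (intro sum.cong) (auto simp: tensor_adj_Cons)
  finally show ?thesis .
qed

text \<open>Both expansions are carried through one induction because the recursion is
  mutual.\<close>

lemma rec_combination:
  assumes core: "skew_symmetric_core q Q" and dec: "disjoint_decomposition q Q A1 A2"
    and T: "\<And>m is. is \<in> tensor_index m \<Longrightarrow> tensor_adj q A1 A2 is \<in> carrier_mat (q ^ m) (q ^ m)"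
  shows "\<exists>c d. \<forall>x<q ^ m. \<forall>y<q ^ m.
    rec_J q Q m $$ (x, y) = (\<Sum>is\<in>tensor_index m. c is * tensor_adj q A1 A2 is $$ (x, y)) \<and>
    rec_A q Q m $$ (x, y) = (\<Sum>is\<in>tensor_index m. d is * tensor_adj q A1 A2 is $$ (x, y))"
proof (induction m)
  case 0
  show ?case
    by (rule exI[of _ "\<lambda>_. 1"])+ (simp add: tensor_index_0 tensor_adj_def all_ones_mat_def)
next
  case (Suc m)
  then obtain c d where cd: "\<And>x y. x < q ^ m \<Longrightarrow> y < q ^ m \<Longrightarrow>
      rec_J q Q m $$ (x, y) = (\<Sum>is\<in>tensor_index m. c is * tensor_adj q A1 A2 is $$ (x, y))"
    "\<And>x y. x < q ^ m \<Longrightarrow> y < q ^ m \<Longrightarrow>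
      rec_A q Q m $$ (x, y) = (\<Sum>is\<in>tensor_index m. d is * tensor_adj q A1 A2 is $$ (x, y))"
    by blast
  note C = rec_carrier[OF skew_symmetric_coreD(1)[OF core], of m]
  have step_J: "(core_mat q Q a b e \<otimes>\<^sub>K rec_J q Q m) $$ (x, y) = (\<Sum>is\<in>tensor_index (Suc m).
      [a + b, b + e, b - e] ! hd is * c (tl is) * tensor_adj q A1 A2 is $$ (x, y))"
    if "x < q ^ Suc m" "y < q ^ Suc m" for a b e x y
    by (rule core_mat_kron_combination[OF core dec C[THEN conjunct1] _ T that]) (rule cd(1))
  have step_A: "(core_mat q Q a b e \<otimes>\<^sub>K rec_A q Q m) $$ (x, y) = (\<Sum>is\<in>tensor_index (Suc m).
      [a + b, b + e, b - e] ! hd is * d (tl is) * tensor_adj q A1 A2 is $$ (x, y))"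
    if "x < q ^ Suc m" "y < q ^ Suc m" for a b e x y
    by (rule core_mat_kron_combination[OF core dec C[THEN conjunct2] _ T that]) (rule cd(2))
  note cA = kron_carrier[OF core_mat_carrier C[THEN conjunct2]]
  have J: "rec_J q Q (Suc m) = core_mat q Q 0 1 0 \<otimes>\<^sub>K rec_A q Q m"
    by (simp flip: core_mat_basis[OF core])
  have A: "rec_A q Q (Suc m) =
      (core_mat q Q 1 0 0 \<otimes>\<^sub>K rec_J q Q m) + (core_mat q Q 0 0 1 \<otimes>\<^sub>K rec_A q Q m)"
    by (simp flip: core_mat_basis[OF core])
  show ?case
  \<comment> \<open>The lists are \<open>[a + b, b + c, b - c]\<close> at the triples of
    \<open>J\<close>, \<open>I\<close> and \<open>Q\<close>, namely (0, 1, 0), (1, 0, 0) and (0, 0,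
    1). They stay unevaluated so as to match \<open>step_J\<close> and
    \<open>step_A\<close>.\<close>
  proof (rule exI[of _ "\<lambda>is. [0 + 1, 1 + 0, 1 - 0] ! hd is * d (tl is)"],
      rule exI[of _ "\<lambda>is. [1 + 0, 0 + 0, 0 - 0] ! hd is * c (tl is) + [0 + 0, 0 + 1, 0 - 1] ! hd is * d (tl is)"],
      intro allI impI conjI, goal_cases)
    case (1 x y)
    show ?case unfolding J by (rule step_A[OF 1])
  next
    case (2 x y)
    have "rec_A q Q (Suc m) $$ (x, y) =
        (core_mat q Q 1 0 0 \<otimes>\<^sub>K rec_J q Q m) $$ (x, y) + (core_mat q Q 0 0 1 \<otimes>\<^sub>K rec_A q Q m) $$ (x, y)"
      unfolding A using 2 carrier_matD[OF cA[of q Q 0 0 1]] by simp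
    also have "\<dots> = (\<Sum>is\<in>tensor_index (Suc m).
        ([1 + 0, 0 + 0, 0 - 0] ! hd is * c (tl is) + [0 + 0, 0 + 1, 0 - 1] ! hd is * d (tl is)) *
          tensor_adj q A1 A2 is $$ (x, y))"
      using 2 by (simp only: step_J step_A distrib_right sum.distrib)
    finally show ?case .
  qed
qed

section \<open>Signs and Gram identities\<close>

text \<open>The two summands of \<open>rec_A\<close> never overlap: in a diagonal block
  \<open>Q\<close> vanishes and only the \<open>rec_J\<close> term survives; elsewhere only the
  \<open>rec_A\<close> term does, with a sign from \<open>Q\<close>.\<close>

lemma rec_entries:
  assumes core: "skew_symmetric_core q Q"
  shows "x < q ^ m \<Longrightarrow> y < q ^ m \<Longrightarrow>
    rec_J q Q m $$ (x, y) \<in> {1, -1} \<and> rec_A q Q m $$ (x, y) \<in> {1, -1}"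
proof (induction m arbitrary: x y)
  case 0
  then show ?case by (simp add: all_ones_mat_def)
next
  case (Suc m)
  note D = skew_symmetric_coreD[OF core]
  note C = rec_carrier[OF D(1), of m]
  let ?N = "q ^ m"
  have xy: "x < q * ?N" "y < q * ?N" using Suc.prems by simp_all
  note bounds = div_mod_less_mult[OF xy(1)] div_mod_less_mult[OF xy(2)]
  note IH = Suc.IH[OF bounds(2,4)]
  have J: "all_ones_mat q q \<in> carrier_mat q q" by (simp add: all_ones_mat_def)
  have "rec_J q Q (Suc m) $$ (x, y) = rec_A q Q m $$ (x mod ?N, y mod ?N)"
    using bounds by (simp add: kron_index[OF J C[THEN conjunct2] xy]) (simp add: all_ones_mat_def)
  moreover have "rec_A q Q (Suc m) $$ (x, y) =
      (if x div ?N = y div ?N then 1 else 0) * rec_J q Q m $$ (x mod ?N, y mod ?N) +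
      Q $$ (x div ?N, y div ?N) * rec_A q Q m $$ (x mod ?N, y mod ?N)"
    using bounds xy carrier_matD[OF kron_carrier[OF D(1) C[THEN conjunct2]]]
    by (simp add: kron_index[OF one_carrier_mat C[THEN conjunct1] xy] kron_index[OF D(1) C[THEN conjunct2] xy])
  moreover have "Q $$ (x div ?N, y div ?N) = 0" if "x div ?N = y div ?N"
    using D(2)[OF bounds(1,3)] that by simp
  ultimately show ?case
    using IH D(3)[OF bounds(1,3)] by auto
qed

text \<open>One level up, \<open>J J^T\<close> becomes \<open>q J_q\<close> tensor
  \<open>A A^T\<close>, and \<open>A A^T\<close> becomes the sum of \<open>I\<close> tensor
  \<open>J J^T\<close>, \<open>Q\<close> tensor \<open>A J^T - J A^T\<close>, and
  \<open>q I - J_q\<close> tensor \<open>A A^T\<close>. The second identity kills the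
  \<open>Q\<close> term, and the \<open>J_q\<close> terms cancel in the weighted sum.\<close>

lemma rec_gram:
  assumes core: "skew_symmetric_core q Q"
  shows "x < q ^ m \<Longrightarrow> y < q ^ m \<Longrightarrow>
    (rec_J q Q m * transpose_mat (rec_J q Q m)) $$ (x, y) +
      of_nat q * (rec_A q Q m * transpose_mat (rec_A q Q m)) $$ (x, y) =
      (if x = y then of_nat (q + 1) * of_nat (q ^ m) else 0) \<and>
    (rec_A q Q m * transpose_mat (rec_J q Q m)) $$ (x, y) =
      (rec_J q Q m * transpose_mat (rec_A q Q m)) $$ (x, y)"
proof (induction m arbitrary: x y)
  case 0
  then show ?case by (simp add: all_ones_mat_def scalar_prod_def)
next
  case (Suc m)
  let ?N = "q ^ m" and ?J = "rec_J q Q m" and ?A = "rec_A q Q m" and ?c = "core_mat q Q"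
  have C: "?J \<in> carrier_mat ?N ?N" "?A \<in> carrier_mat ?N ?N"
      "transpose_mat ?J \<in> carrier_mat ?N ?N" "transpose_mat ?A \<in> carrier_mat ?N ?N"
    using rec_carrier[OF skew_symmetric_coreD(1)[OF core], of m] by auto
  have xy: "x < q * ?N" "y < q * ?N" using Suc.prems by simp_all
  note bounds = div_mod_less_mult[OF xy(1)] div_mod_less_mult[OF xy(2)]
  note IH = Suc.IH[OF bounds(2,4)]
  have J: "rec_J q Q (Suc m) = ?c 0 1 0 \<otimes>\<^sub>K ?A"
    by (simp flip: core_mat_basis[OF core])
  have A: "rec_A q Q (Suc m) = (?c 1 0 0 \<otimes>\<^sub>K ?J) + (?c 0 0 1 \<otimes>\<^sub>K ?A)"
    by (simp flip: core_mat_basis[OF core])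
  note K = kron_carrier[OF core_mat_carrier C(1)] kron_carrier[OF core_mat_carrier C(2)]
    kron_carrier[OF core_mat_carrier C(3)] kron_carrier[OF core_mat_carrier C(4)]
  have JT: "transpose_mat (rec_J q Q (Suc m)) = ?c 0 1 0 \<otimes>\<^sub>K transpose_mat ?A"
    unfolding J by (simp add: kron_transpose[OF core_mat_carrier C(2)] core_mat_transpose[OF core])
  have AT: "transpose_mat (rec_A q Q (Suc m)) =
      (?c 1 0 0 \<otimes>\<^sub>K transpose_mat ?J) + (?c 0 0 (-1) \<otimes>\<^sub>K transpose_mat ?A)"
    unfolding A transpose_add[OF K(1,2)]
    by (simp add: kron_transpose[OF core_mat_carrier C(1)] kron_transpose[OF core_mat_carrier C(2)]
      core_mat_transpose[OF core])
  let ?e = "\<lambda>M. M $$ (x mod ?N, y mod ?N)"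
  have mult: "((?c a b c \<otimes>\<^sub>K X) * (?c a' b' c' \<otimes>\<^sub>K Y)) $$ (x, y) =
      (?c a b c * ?c a' b' c') $$ (x div ?N, y div ?N) * ?e (X * Y)"
    if "X \<in> carrier_mat ?N ?N" "Y \<in> carrier_mat ?N ?N" for a b c a' b' c' X Y
    by (rule kron_mult_index[OF core_mat_carrier that(1) core_mat_carrier that(2) xy])
  have addl: "((X + Y) * Z) $$ (x, y) = (X * Z) $$ (x, y) + (Y * Z) $$ (x, y)"
    and addr: "(Z * (X + Y)) $$ (x, y) = (Z * X) $$ (x, y) + (Z * Y) $$ (x, y)"
    if "X \<in> carrier_mat (q * ?N) (q * ?N)" "Y \<in> carrier_mat (q * ?N) (q * ?N)"
      "Z \<in> carrier_mat (q * ?N) (q * ?N)" for X Y Z :: "complex mat"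
    using that xy by (simp_all add: add_mult_distrib_mat[OF that] mult_add_distrib_mat[OF that(3,1,2)])
  note simps = addl addr K add_carrier_mat mult C core_mat_mult[OF core] core_mat_index[OF bounds(1,3)]
  have JJ: "(rec_J q Q (Suc m) * transpose_mat (rec_J q Q (Suc m))) $$ (x, y) =
      of_nat q * ?e (?A * transpose_mat ?A)"
    unfolding JT unfolding J by (simp add: simps)
  \<comment> \<open>Since \<open>Q J_q = 0\<close>, only the identity term of \<open>rec_A\<close>
    contributes. The roles of the two matrices swap, here and in \<open>JA\<close>, so the second
    identity passes to the next level.\<close>
  have AJ: "(rec_A q Q (Suc m) * transpose_mat (rec_J q Q (Suc m))) $$ (x, y) =
      ?e (?J * transpose_mat ?A)"
    unfolding JT unfolding A by (simp add: simps)
  have JA: "(rec_J q Q (Suc m) * transpose_mat (rec_A q Q (Suc m))) $$ (x, y) =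
      ?e (?A * transpose_mat ?J)"
    unfolding AT unfolding J by (simp add: simps)
  have AA: "(rec_A q Q (Suc m) * transpose_mat (rec_A q Q (Suc m))) $$ (x, y) =
      (if x div ?N = y div ?N then 1 else 0) * ?e (?J * transpose_mat ?J) +
      Q $$ (x div ?N, y div ?N) * (?e (?A * transpose_mat ?J) - ?e (?J * transpose_mat ?A)) +
      ((if x div ?N = y div ?N then of_nat q else 0) - 1) * ?e (?A * transpose_mat ?A)"
    unfolding AT unfolding A by (simp add: simps algebra_simps)
  have eq: "x = y \<longleftrightarrow> x div ?N = y div ?N \<and> x mod ?N = y mod ?N"
    by (metis div_mult_mod_eq)
  have "(rec_J q Q (Suc m) * transpose_mat (rec_J q Q (Suc m))) $$ (x, y) +
      of_nat q * (rec_A q Q (Suc m) * transpose_mat (rec_A q Q (Suc m))) $$ (x, y) =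
      (if x div ?N = y div ?N then of_nat q else 0) *
        (?e (?J * transpose_mat ?J) + of_nat q * ?e (?A * transpose_mat ?A))"
    unfolding JJ AA IH[THEN conjunct2] by (simp add: algebra_simps)
  \<comment> \<open>Two indices agree exactly when quotient and remainder agree; the block delta
    supplies the extra factor \<open>q\<close>.\<close>
  also have "\<dots> = (if x = y then of_nat (q + 1) * of_nat (q ^ Suc m) else 0)"
    unfolding IH[THEN conjunct1] eq by (simp add: algebra_simps)
  finally show ?case
    using IH AJ JA by simp
qed

section \<open>The quaternary unit Hadamard matrix\<close>

lemma mat_adjoint_carrier: "A \<in> carrier_mat n m \<Longrightarrow> mat_adjoint A \<in> carrier_mat m n"
  by (auto simp: mat_adjoint_def)

lemma mat_adjoint_index:
  fixes A :: "complex mat"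
  assumes "A \<in> carrier_mat n m" "i < m" "j < n"
  shows "mat_adjoint A $$ (i, j) = cnj (A $$ (j, i))"
  using assms by (auto simp: mat_adjoint_def mat_of_rows_index)

text \<open>With \<open>a^2 = 1 / (q + 1)\<close> and \<open>b^2 = q / (q + 1)\<close>, the product
  of \<open>H\<close> and its adjoint is \<open>(J J^T + q A A^T) / (q + 1)\<close> plus cross terms
  that cancel because \<open>A J^T = J A^T\<close>.\<close>

lemma quaternary_unit_hadamard_rec:
  assumes core: "skew_symmetric_core q Q"
  shows "quaternary_unit_hadamard_mat q (q ^ m)
    (complex_of_real (1 / sqrt (real q + 1)) \<cdot>\<^sub>m rec_J q Q m
      + (\<i> * complex_of_real (sqrt (real q / (real q + 1)))) \<cdot>\<^sub>m rec_A q Q m)"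
proof -
  define a where "a = 1 / sqrt (real q + 1)"
  define b where "b = sqrt (real q / (real q + 1))"
  let ?J = "rec_J q Q m" and ?A = "rec_A q Q m" and ?N = "q ^ m"
  define H where "H = complex_of_real a \<cdot>\<^sub>m ?J + (\<i> * complex_of_real b) \<cdot>\<^sub>m ?A"
  have C: "?J \<in> carrier_mat ?N ?N" "?A \<in> carrier_mat ?N ?N"
    using rec_carrier[OF skew_symmetric_coreD(1)[OF core], of m] by auto
  have H: "H \<in> carrier_mat ?N ?N" using C by (simp add: H_def)
  have Hxy: "H $$ (x, y) = of_real a * ?J $$ (x, y) + \<i> * of_real b * ?A $$ (x, y)"
    if "x < ?N" "y < ?N" for x y
    using that C by (simp add: H_def)
  \<comment> \<open>The entries are signs, so conjugating \<open>H\<close> affects only the factor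
    \<open>\<i>\<close>.\<close>
  have real: "cnj (?J $$ (x, y)) = ?J $$ (x, y)" "cnj (?A $$ (x, y)) = ?A $$ (x, y)"
    if "x < ?N" "y < ?N" for x y
    using rec_entries[OF core that] by auto
  have a2: "complex_of_real a * of_real a = 1 / (of_nat q + 1)"
    by (simp add: a_def flip: of_real_mult)
  have b2: "complex_of_real b * of_real b = of_nat q / (of_nat q + 1)"
    by (simp add: b_def flip: of_real_mult)
  have q1: "(of_nat q + 1 :: complex) \<noteq> 0"
    by (metis of_nat_Suc of_nat_eq_0_iff nat.distinct(1) add.commute)
  have "H * mat_adjoint H = of_nat ?N \<cdot>\<^sub>m 1\<^sub>m ?N"
  proof (rule eq_matI)
    fix x y assume "x < dim_row (of_nat ?N \<cdot>\<^sub>m 1\<^sub>m ?N :: complex mat)"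
      "y < dim_col (of_nat ?N \<cdot>\<^sub>m 1\<^sub>m ?N :: complex mat)"
    then have xy: "x < ?N" "y < ?N" by auto
    have gram: "(X * transpose_mat Y) $$ (x, y) = (\<Sum>z<?N. X $$ (x, z) * Y $$ (y, z))"
      if "X \<in> carrier_mat ?N ?N" "Y \<in> carrier_mat ?N ?N" for X Y :: "complex mat"
      using that xy by (subst mult_index_sum[OF that(1) _ xy]) auto
    have "(H * mat_adjoint H) $$ (x, y) = (\<Sum>z<?N. H $$ (x, z) * cnj (H $$ (y, z)))"
      using xy by (subst mult_index_sum[OF H mat_adjoint_carrier[OF H] xy])
        (auto simp: mat_adjoint_index[OF H])
    also have "\<dots> = (\<Sum>z<?N. of_real a * of_real a * (?J $$ (x, z) * ?J $$ (y, z)) +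
        of_real b * of_real b * (?A $$ (x, z) * ?A $$ (y, z)) +
        \<i> * of_real a * of_real b * (?A $$ (x, z) * ?J $$ (y, z)) -
        \<i> * of_real a * of_real b * (?J $$ (x, z) * ?A $$ (y, z)))"
      using xy by (intro sum.cong) (auto simp: Hxy real algebra_simps)
    also have "\<dots> = of_real a * of_real a * (?J * transpose_mat ?J) $$ (x, y) +
        of_real b * of_real b * (?A * transpose_mat ?A) $$ (x, y) +
        \<i> * of_real a * of_real b * (?A * transpose_mat ?J) $$ (x, y) -
        \<i> * of_real a * of_real b * (?J * transpose_mat ?A) $$ (x, y)"
      unfolding gram[OF C(1,1)] gram[OF C(2,2)] gram[OF C(1,2)] gram[OF C(2,1)]
        sum_subtractf sum.distrib sum_distrib_left ..
    also have "\<dots> = ((?J * transpose_mat ?J) $$ (x, y) + of_nat q * (?A * transpose_mat ?A) $$ (x, y)) /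
        (of_nat q + 1)"
      unfolding a2 b2 rec_gram[OF core xy, THEN conjunct2] by (simp add: add_divide_distrib)
    also have "\<dots> = (of_nat ?N \<cdot>\<^sub>m 1\<^sub>m ?N) $$ (x, y)"
      unfolding rec_gram[OF core xy, THEN conjunct1] using xy q1 by (simp add: add.commute)
    finally show "(H * mat_adjoint H) $$ (x, y) = (of_nat ?N \<cdot>\<^sub>m 1\<^sub>m ?N) $$ (x, y)" .
  qed (use H mat_adjoint_carrier[OF H] in auto)
  moreover have "elements_mat H \<subseteq>
       {\<epsilon> * complex_of_real a + \<delta> * \<i> * complex_of_real b | \<epsilon> \<delta>. \<epsilon> \<in> {1, -1} \<and> \<delta> \<in> {1, -1}}"
  proof
    fix h assume "h \<in> elements_mat H"
    then obtain x y where xy: "x < ?N" "y < ?N" "h = H $$ (x, y)"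
      using H elements_matD[of h H] by auto
    have "h = ?J $$ (x, y) * complex_of_real a + ?A $$ (x, y) * \<i> * complex_of_real b"
      using xy by (simp add: Hxy algebra_simps)
    then show "h \<in> {\<epsilon> * complex_of_real a + \<delta> * \<i> * complex_of_real b | \<epsilon> \<delta>.
        \<epsilon> \<in> {1, -1} \<and> \<delta> \<in> {1, -1}}"
      using rec_entries[OF core xy(1,2)] by blast
  qed
  ultimately have "quaternary_unit_hadamard_mat q ?N H"
    using H by (simp add: quaternary_unit_hadamard_mat_def a_def b_def)
  then show ?thesis by (simp add: H_def a_def b_def)
qed

theorem proposition4p1:
  fixes Q A1 A2 :: "complex mat" and q m :: nat
  assumes "skew_symmetric_core q Q"
    and "q > 1"
    and "m > 0"
    and "disjoint_decomposition q Q A1 A2"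
  shows "let H = complex_of_real (1 / sqrt (real q + 1)) \<cdot>\<^sub>m rec_J q Q m
               + (\<i> * complex_of_real (sqrt (real q / (real q + 1)))) \<cdot>\<^sub>m rec_A q Q m
         in quaternary_unit_hadamard_mat q (q ^ m) H \<and>
            commutative_association_scheme (q ^ m) (tensor_index m) (tensor_adj q A1 A2) \<and>
            H \<in> bose_mesner_algebra (q ^ m) (tensor_index m) (tensor_adj q A1 A2)"
proof -
  \<comment> \<open>Stated for every exponent, since the induction behind the tensor expansion uses
    the carriers at all levels.\<close>
  have S: "commutative_association_scheme (q ^ m) (tensor_index m) (tensor_adj q A1 A2)" for m
    using assms by (intro commutative_association_scheme_tensor commutative_association_scheme_core)
  note T = commutative_association_schemeD(2)[OF S]
  have C: "rec_J q Q m \<in> carrier_mat (q ^ m) (q ^ m)" "rec_A q Q m \<in> carrier_mat (q ^ m) (q ^ m)"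
    using rec_carrier[OF skew_symmetric_coreD(1)[OF assms(1)], of m] by auto
  obtain c d where cd: "\<And>x y. x < q ^ m \<Longrightarrow> y < q ^ m \<Longrightarrow>
      rec_J q Q m $$ (x, y) = (\<Sum>is\<in>tensor_index m. c is * tensor_adj q A1 A2 is $$ (x, y))"
    "\<And>x y. x < q ^ m \<Longrightarrow> y < q ^ m \<Longrightarrow>
      rec_A q Q m $$ (x, y) = (\<Sum>is\<in>tensor_index m. d is * tensor_adj q A1 A2 is $$ (x, y))"
    using rec_combination[OF assms(1,4) T, of m] by blast
  have "rec_J q Q m \<in> bose_mesner_algebra (q ^ m) (tensor_index m) (tensor_adj q A1 A2)"
    "rec_A q Q m \<in> bose_mesner_algebra (q ^ m) (tensor_index m) (tensor_adj q A1 A2)"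
    using bose_mesner_algebraI[where A = "tensor_adj q A1 A2",
        OF commutative_association_schemeD(1)[OF S] T] C cd by blast+
  then have "\<alpha> \<cdot>\<^sub>m rec_J q Q m + \<beta> \<cdot>\<^sub>m rec_A q Q m \<in>
      bose_mesner_algebra (q ^ m) (tensor_index m) (tensor_adj q A1 A2)" for \<alpha> \<beta>
    using bose_mesner_algebra_closed(3,4)[where A = "tensor_adj q A1 A2", OF T] by blast
  then show ?thesis
    using quaternary_unit_hadamard_rec[OF assms(1)] S by (simp add: Let_def)
qed

end
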